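(* Let $G$ be a tree on $k$ vertices and $n\ge 1$. Then $$\begin{aligned}W(\Gamma^G_n)&=\frac{(k-1)^2(2k^2-2k-1)}{k^3(2k-1)}\,2^nk^{2n}-\frac{2(k-1)^2}{k^2}\,nk^{2n}+\frac{2(k+1)(k-1)}{k^3}\,k^{2n}-\frac{2(k+1)(k-1)}{k(2k-1)}\,k^n\\&\quad+\left(\frac{2}{k^2}\,nk^{2n}-\frac{k^2+2}{k^3(k-1)}\,k^{2n}+\frac{k+2}{k^2(k-1)}\,k^n\right)W(G).\end{aligned}$$
   Context: Let $G=(V,E)$ be a finite tree with vertex set $V$ of size $k$, and fix an orientation of each edge, so that each edge becomes an ordered pair $e=(s,t)$. Each oriented edge $e=(s,t)$ acts on the set $V^*$ of finite words over the alphabet $V$ by the recursive rule: $e(\emptyset)=\emptyset$, $e(sw)=t\,e(w)$, $e(tw)=sw$, and $e(xw)=xw$ for $x\in V\setminus\{s,t\}$ (words are read left to right, $w\in V^*$). This action preserves word length. For $n\ge 1$, the Schreier graph $\Gamma_n^G$ is the multigraph with vertex set $V^n$ having, for each $u\in V^n$ and each oriented edge $e$ of $G$, one edge joining $u$ and $e(u)$, labelled $e$ (a loop if $e(u)=u$). For a connected graph $H$, the Wiener index is $W(H)=\sum_{\{u,v\}}d_H(u,v)$, the sum of graph distances over all unordered pairs of vertices. *)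

theory Defs
  imports Complex_Main
begin

(* Undirected adjacency induced by a set of oriented edges *)
definition adj :: "('a \<times> 'a) set \<Rightarrow> 'a \<Rightarrow> 'a \<Rightarrow> bool" where
  "adj E x y \<longleftrightarrow> (x, y) \<in> E \<or> (y, x) \<in> E"

(* A cycle: at least 3 distinct vertices, consecutive ones (cyclically) adjacent *)
definition is_cycle :: "('a \<times> 'a) set \<Rightarrow> 'a list \<Rightarrow> bool" where
  "is_cycle E cs \<longleftrightarrow> length cs \<ge> 3 \<and> distinct cs \<and>
     (\<forall>i < length cs. adj E (cs ! i) (cs ! ((i + 1) mod length cs)))"

(* A finite tree with vertex set V whose edges are oriented: E contains, for each
   (undirected) edge of the tree, exactly one orientation (s,t). *)
definition oriented_tree :: "'a set \<Rightarrow> ('a \<times> 'a) set \<Rightarrow> bool" where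
  "oriented_tree V E \<longleftrightarrow> finite V \<and> V \<noteq> {} \<and> E \<subseteq> V \<times> V \<and>
     (\<forall>(s, t) \<in> E. s \<noteq> t \<and> (t, s) \<notin> E) \<and>
     (\<forall>u \<in> V. \<forall>v \<in> V. (u, v) \<in> {(x, y). adj E x y}\<^sup>*) \<and>
     (\<not> (\<exists>cs. set cs \<subseteq> V \<and> is_cycle E cs))"

(* Action of the oriented edge e = (s,t) on words *)
fun edge_act :: "'a \<times> 'a \<Rightarrow> 'a list \<Rightarrow> 'a list" where
  "edge_act e [] = []"
| "edge_act (s, t) (x # w) =
     (if x = s then t # edge_act (s, t) w
      else if x = t then s # w
      else x # w)"

(* Words of length n over V *)
definition words :: "'a set \<Rightarrow> nat \<Rightarrow> 'a list set" where
  "words V n = {w. length w = n \<and> set w \<subseteq> V}"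

(* Adjacency relation of the Schreier graph Gamma_n (undirected: u -- e(u)) *)
definition schreier_rel :: "'a set \<Rightarrow> ('a \<times> 'a) set \<Rightarrow> nat \<Rightarrow> ('a list \<times> 'a list) set" where
  "schreier_rel V E n =
     {(u, v). u \<in> words V n \<and> v \<in> words V n \<and>
              (\<exists>e \<in> E. v = edge_act e u \<or> u = edge_act e v)}"

(* Graph distance w.r.t. an adjacency relation R: least number of steps *)
definition gdist :: "('b \<times> 'b) set \<Rightarrow> 'b \<Rightarrow> 'b \<Rightarrow> nat" where
  "gdist R u v = (LEAST m. (u, v) \<in> R ^^ m)"

(* Wiener index: sum of distances over unordered pairs = half the ordered sum *)
definition wiener :: "'b set \<Rightarrow> ('b \<times> 'b) set \<Rightarrow> real" where
  "wiener X R = (\<Sum>u\<in>X. \<Sum>v\<in>X. real (gdist R u v)) / 2"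

end

theory Submission
  imports Defs "HOL-Library.Sublist" "HOL-Library.Transitive_Closure_Table"
begin

text \<open>
  The Schreier graph is a cactus: an oriented edge \<open>e = (s, t)\<close> acts on words over \<open>{s, t}\<close> as an adding
  machine, so its orbits are cycles \<open>{s, t}\<^sup>m \<tau>\<close> of length \<open>2\<^sup>m\<close>, where the suffix \<open>\<tau>\<close> is empty or starts
  with a letter outside \<open>{s, t}\<close>.  Each word has a projection to each cycle; one step along \<open>e\<close> changes
  only the projection to the \<open>e\<close>-cycle through the current word, and distinct words have distinct
  projections to some cycle through the first of them.  Two opposite edges of a cycle cut the graph
  into two parts, every step crosses at most one of these cuts, and the distance of two words is the
  number of cuts separating them.  So the Wiener index is the sum over all cuts of the product of the
  sizes of the two parts, just as \<open>W(G)\<close> is the sum of \<open>a b\<close> over the edges of the tree, which split it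
  into parts of \<open>a\<close> and \<open>b\<close> vertices.

  All but one of the \<open>2\<^sup>j\<close> cuts of a cycle of length \<open>2 * 2\<^sup>j\<close> cut off \<open>k\<^sup>j\<close> words, and the last one cuts
  off \<open>a k\<^sup>j\<close> or \<open>b k\<^sup>j\<close> words.  Summing geometric series over \<open>j\<close>, the contribution of an edge depends
  only on \<open>a b\<close>, and affinely so.
\<close>

section \<open>Distances as numbers of separating cuts\<close>

lemma gdist_le: "(u, v) \<in> R ^^ m \<Longrightarrow> gdist R u v \<le> m"
  unfolding gdist_def by (rule Least_le)

lemma relpow_gdist: "(u, v) \<in> R ^^ m \<Longrightarrow> (u, v) \<in> R ^^ gdist R u v"
  unfolding gdist_def by (rule LeastI)

lemma le_relpow_length:
  fixes D :: "'b \<Rightarrow> nat"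
  assumes step: "\<And>u u'. (u, u') \<in> R \<Longrightarrow> D u \<le> Suc (D u')"
    and "D v = 0" "(u, v) \<in> R ^^ m"
  shows "D u \<le> m"
  using assms(3)
proof (induction m arbitrary: u)
  case 0
  then show ?case using \<open>D v = 0\<close> by simp
next
  case (Suc m)
  then obtain u' where "(u, u') \<in> R" "(u', v) \<in> R ^^ m"
    by (meson relpow_Suc_D2)
  then show ?case using step Suc.IH by (meson Suc_le_mono le_trans)
qed

lemma relpow_if_descent:
  fixes D :: "'b \<Rightarrow> nat"
  assumes "R \<subseteq> X \<times> X"
    and descent: "\<And>u. u \<in> X \<Longrightarrow> u \<noteq> v \<Longrightarrow> \<exists>u'. (u, u') \<in> R \<and> D u' < D u"
    and "u \<in> X"
  shows "\<exists>m \<le> D u. (u, v) \<in> R ^^ m"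
  using \<open>u \<in> X\<close>
proof (induction "D u" arbitrary: u rule: less_induct)
  case less
  show ?case
  proof (cases "u = v")
    case True
    then show ?thesis by (intro exI[of _ 0]) simp
  next
    case False
    then obtain u' where u': "(u, u') \<in> R" "D u' < D u"
      using descent less.prems by blast
    then obtain m where m: "m \<le> D u'" "(u', v) \<in> R ^^ m"
      using less.hyps \<open>R \<subseteq> X \<times> X\<close> by blast
    have "Suc m \<le> D u" using m(1) u'(2) by simp
    moreover have "(u, v) \<in> R ^^ Suc m" using u'(1) m(2) by (rule relpow_Suc_I2)
    ultimately show ?thesis by blast
  qed
qed

lemma gdist_eqI:
  fixes D :: "'b \<Rightarrow> nat"
  assumes "R \<subseteq> X \<times> X"
    and step: "\<And>u u'. (u, u') \<in> R \<Longrightarrow> D u \<le> Suc (D u')"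
    and "\<And>u. u \<in> X \<Longrightarrow> u \<noteq> v \<Longrightarrow> \<exists>u'. (u, u') \<in> R \<and> D u' < D u"
    and "D v = 0" "u \<in> X"
  shows "gdist R u v = D u"
proof -
  obtain m where m: "m \<le> D u" "(u, v) \<in> R ^^ m"
    using relpow_if_descent[of R X v D u] assms by blast
  have "gdist R u v \<le> D u" using gdist_le[OF m(2)] m(1) by simp
  moreover have "D u \<le> gdist R u v"
    using step \<open>D v = 0\<close> relpow_gdist[OF m(2)] by (rule le_relpow_length)
  ultimately show ?thesis by (rule antisym)
qed

definition separated_pairs :: "'b set \<Rightarrow> ('b \<Rightarrow> bool) \<Rightarrow> real" where
  "separated_pairs X P = real (card {u \<in> X. P u}) * real (card {u \<in> X. \<not> P u})"

lemma sum_of_bool_neq: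
  assumes "finite X"
  shows "(\<Sum>u\<in>X. \<Sum>v\<in>X. of_bool (P u \<noteq> P v)) = 2 * separated_pairs X P"
proof -
  have product: "(\<Sum>u\<in>X. \<Sum>v\<in>X. of_bool (P u) * of_bool (Q v)) =
      real (card {u \<in> X. P u}) * real (card {u \<in> X. Q u})" for P Q
    using assms by (subst sum_product[symmetric]) (simp add: Int_def)
  have "(\<Sum>u\<in>X. \<Sum>v\<in>X. of_bool (P u \<noteq> P v)) =
      (\<Sum>u\<in>X. \<Sum>v\<in>X. of_bool (P u) * of_bool (\<not> P v) + of_bool (\<not> P u) * of_bool (P v) :: real)"
    by (intro sum.cong refl) auto
  also have "\<dots> = real (card {u \<in> X. P u}) * real (card {u \<in> X. \<not> P u})
      + real (card {u \<in> X. \<not> P u}) * real (card {u \<in> X. P u})"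
    by (simp only: sum.distrib product)
  finally show ?thesis by (simp only: separated_pairs_def mult_2 mult.commute)
qed

lemma card_filter_add_card_not:
  assumes "finite X"
  shows "card {u \<in> X. P u} + card {u \<in> X. \<not> P u} = card X"
proof -
  have "card {u \<in> X. P u} + card {u \<in> X. \<not> P u} = card ({u \<in> X. P u} \<union> {u \<in> X. \<not> P u})"
    using assms by (intro card_Un_disjoint[symmetric]) auto
  also have "{u \<in> X. P u} \<union> {u \<in> X. \<not> P u} = X" by auto
  finally show ?thesis .
qed

lemma separated_pairs_eq:
  assumes "finite X"
  shows "separated_pairs X P =
    real (card {u \<in> X. P u \<noteq> b}) * (real (card X) - real (card {u \<in> X. P u \<noteq> b}))"
  using card_filter_add_card_not[OF assms, of P]
  by (cases b) (simp_all add: separated_pairs_def flip: of_nat_add)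

locale cut_system =
  fixes X :: "'b set" and R :: "('b \<times> 'b) set" and I :: "'i set" and cut :: "'i \<Rightarrow> 'b \<Rightarrow> bool"
  assumes finite_X: "finite X" and finite_I: "finite I" and R_subset: "R \<subseteq> X \<times> X"
    and step_crosses_one: "(u, u') \<in> R \<Longrightarrow> \<exists>i. \<forall>j \<in> I - {i}. cut j u' = cut j u"
    and crossing_step: "u \<in> X \<Longrightarrow> v \<in> X \<Longrightarrow> u \<noteq> v \<Longrightarrow>
      \<exists>i \<in> I. \<exists>u'. (u, u') \<in> R \<and> cut i u \<noteq> cut i v \<and> cut i u' \<noteq> cut i u"
begin

definition separating :: "'b \<Rightarrow> 'b \<Rightarrow> 'i set" where
  "separating u v = {i \<in> I. cut i u \<noteq> cut i v}"

lemma finite_separating: "finite (separating u v)"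
  using finite_I by (simp add: separating_def)

lemma gdist_eq_card_separating:
  assumes "u \<in> X" "v \<in> X"
  shows "gdist R u v = card (separating u v)"
proof (rule gdist_eqI[OF R_subset])
  show "card (separating v v) = 0" by (simp add: separating_def)
  show "card (separating u v) \<le> Suc (card (separating u' v))" if step: "(u, u') \<in> R" for u u'
  proof -
    obtain i where "separating u v \<subseteq> insert i (separating u' v)"
      using step_crosses_one[OF step] by (fastforce simp: separating_def)
    then have "card (separating u v) \<le> card (insert i (separating u' v))"
      by (intro card_mono) (simp_all add: finite_separating)
    also have "\<dots> \<le> Suc (card (separating u' v))" by (rule card_insert_le_m1) auto
    finally show ?thesis .
  qed
  show "\<exists>u'. (u, u') \<in> R \<and> card (separating u' v) < card (separating u v)"
    if u: "u \<in> X" "u \<noteq> v" for u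
  proof -
    obtain i u' where u': "i \<in> I" "(u, u') \<in> R" "cut i u \<noteq> cut i v" "cut i u' \<noteq> cut i u"
      using crossing_step[OF u(1) \<open>v \<in> X\<close> u(2)] by blast
    then have "\<forall>j \<in> I - {i}. cut j u' = cut j u" using step_crosses_one by blast
    then have "separating u' v \<subset> separating u v"
      using u' by (auto simp: separating_def)
    then show ?thesis using u'(2) finite_separating psubset_card_mono by blast
  qed
qed (use assms in auto)

lemma wiener_eq_sum_cuts: "wiener X R = (\<Sum>i\<in>I. separated_pairs X (cut i))"
proof -
  have "(\<Sum>u\<in>X. \<Sum>v\<in>X. real (gdist R u v)) =
      (\<Sum>u\<in>X. \<Sum>v\<in>X. \<Sum>i\<in>I. of_bool (cut i u \<noteq> cut i v))"
    using finite_I by (intro sum.cong refl) (simp add: gdist_eq_card_separating separating_def Int_def)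
  also have "\<dots> = (\<Sum>u\<in>X. \<Sum>i\<in>I. \<Sum>v\<in>X. of_bool (cut i u \<noteq> cut i v))"
    by (intro sum.cong refl sum.swap)
  also have "\<dots> = (\<Sum>i\<in>I. \<Sum>u\<in>X. \<Sum>v\<in>X. of_bool (cut i u \<noteq> cut i v))"
    by (rule sum.swap)
  also have "\<dots> = 2 * (\<Sum>i\<in>I. separated_pairs X (cut i))"
    unfolding sum_distrib_left by (intro sum.cong refl sum_of_bool_neq finite_X)
  finally show ?thesis by (simp add: wiener_def)
qed

end

section \<open>Sides of the edges of a tree\<close>

abbreviation ends :: "'a \<times> 'a \<Rightarrow> 'a set" where
  "ends e \<equiv> {fst e, snd e}"

definition side :: "('a \<times> 'a) set \<Rightarrow> 'a \<times> 'a \<Rightarrow> 'a \<Rightarrow> bool" where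
  "side E e x \<longleftrightarrow> (adj (E - {e}))\<^sup>*\<^sup>* (fst e) x"

lemma adj_sym: "adj E x y \<longleftrightarrow> adj E y x"
  by (auto simp: adj_def)

lemma side_fst: "side E e (fst e)"
  by (simp add: side_def)

lemma side_adj:
  assumes "adj (E - {e}) x y"
  shows "side E e x \<longleftrightarrow> side E e y"
  using assms adj_sym[of "E - {e}" x y] unfolding side_def by (meson rtranclp.rtrancl_into_rtrancl)

lemma is_cycleI:
  assumes "rtrancl_path (adj E) x xs y" "adj E y x" "distinct (x # xs)" "length xs \<ge> 2"
  shows "is_cycle E (x # xs)"
  unfolding is_cycle_def
proof (intro conjI allI impI)
  fix i assume "i < length (x # xs)"
  then consider (inner) "i < length xs" | (closing) "i = length xs" by fastforce
  then show "adj E ((x # xs) ! i) ((x # xs) ! ((i + 1) mod length (x # xs)))"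
  proof cases
    case inner
    then show ?thesis using rtrancl_path_nth[OF assms(1)] by simp
  next
    case closing
    have "xs \<noteq> []" using assms(4) by auto
    then have "(x # xs) ! length xs = y"
      using rtrancl_path_last[OF assms(1)] by (simp add: last_conv_nth)
    then show ?thesis using closing assms(2) by simp
  qed
qed (use assms in auto)

locale tree_graph =
  fixes V :: "'a set" and E :: "('a \<times> 'a) set"
  assumes tree: "oriented_tree V E"
begin

lemma finite_V: "finite V" and V_nonempty: "V \<noteq> {}" and E_subset: "E \<subseteq> V \<times> V"
  using tree by (auto simp: oriented_tree_def)

lemma finite_E: "finite E"
  using E_subset finite_V by (meson finite_SigmaI finite_subset)

lemma ends_subset: "e \<in> E \<Longrightarrow> ends e \<subseteq> V"
  using E_subset by auto

lemma edge_neq: "e \<in> E \<Longrightarrow> fst e \<noteq> snd e"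
  using tree by (auto simp: oriented_tree_def)

lemma connected: "u \<in> V \<Longrightarrow> v \<in> V \<Longrightarrow> (adj E)\<^sup>*\<^sup>* u v"
  using tree by (auto simp: oriented_tree_def rtranclp_rtrancl_eq)

lemma not_side_snd:
  assumes "e \<in> E"
  shows "\<not> side E e (snd e)"
proof
  obtain s t where e: "e = (s, t)" by (cases e)
  have st: "s \<noteq> t" "(t, s) \<notin> E" using tree assms e by (auto simp: oriented_tree_def)
  assume "side E e (snd e)"
  then have "\<exists>xs. rtrancl_path (adj (E - {e})) s xs t"
    using e by (simp add: side_def rtranclp_eq_rtrancl_path)
  then obtain xs where path: "rtrancl_path (adj (E - {e})) s xs t" and "distinct (s # xs)"
    using rtrancl_path_distinct by metis
  have "xs \<noteq> []" using path st(1) by (auto elim: rtrancl_path.cases)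
  moreover have "xs \<noteq> [t]"
  proof
    assume "xs = [t]"
    then have "adj (E - {e}) s t" using rtrancl_path_nth[OF path, of 0] by simp
    then show False using e st by (simp add: adj_def)
  qed
  ultimately have "length xs \<ge> 2"
    using rtrancl_path_last[OF path] by (cases xs; cases "tl xs") auto
  have path_E: "rtrancl_path (adj E) s xs t"
    using path by (rule rtrancl_path_mono) (auto simp: adj_def)
  moreover have "adj E t s" using assms e by (simp add: adj_def)
  ultimately have "is_cycle E (s # xs)"
    using \<open>distinct (s # xs)\<close> \<open>length xs \<ge> 2\<close> by (rule is_cycleI)
  moreover have "set (s # xs) \<subseteq> V"
    using rtrancl_path_Range[OF path_E] assms e E_subset by (auto simp: adj_def Rangep.simps)
  ultimately show False using tree by (auto simp: oriented_tree_def)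
qed

lemma side_inj_on_ends: "e \<in> E \<Longrightarrow> inj_on (side E e) (ends e)"
  using side_fst[of E e] not_side_snd[of e] by (auto simp: inj_on_def)

lemma side_other_edge:
  assumes "e \<in> E" "e' \<noteq> e"
  shows "side E e' (fst e) \<longleftrightarrow> side E e' (snd e)"
  using assms by (intro side_adj) (simp add: adj_def)

lemma adj_edgeE:
  assumes "adj E x y"
  obtains e where "e \<in> E" "e = (x, y) \<or> e = (y, x)" "\<And>e'. e' \<noteq> e \<Longrightarrow> side E e' x = side E e' y"
proof -
  obtain e where e: "e \<in> E" "e = (x, y) \<or> e = (y, x)" using assms by (auto simp: adj_def)
  then have "side E e' x = side E e' y" if "e' \<noteq> e" for e'
    using side_other_edge[OF e(1) that] by auto
  with e show thesis by (rule that)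
qed

lemma separating_edge:
  assumes "c \<in> V" "d \<in> V" "c \<noteq> d"
  obtains e where "e \<in> E" "c \<in> ends e" "side E e c \<noteq> side E e d"
proof -
  have "(adj E)\<^sup>*\<^sup>* d c" using connected assms by blast
  then have "d = c \<or> (\<exists>e \<in> E. c \<in> ends e \<and> side E e c \<noteq> side E e d)"
  proof (induction rule: converse_rtranclp_induct)
    case (step x y)
    obtain e' where e': "e' \<in> E" "e' = (x, y) \<or> e' = (y, x)"
        "\<And>e. e \<noteq> e' \<Longrightarrow> side E e x = side E e y"
      using step.hyps(1) by (rule adj_edgeE) blast
    consider "x = c" | (last_step) "y = c" "x \<noteq> c" | (earlier_step) "y \<noteq> c" "x \<noteq> c" by blast
    then show ?case
    proof cases
      case last_step
      then have "side E e' c \<noteq> side E e' x"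
        using e' side_inj_on_ends[OF e'(1)] by (auto simp: inj_on_def)
      then show ?thesis using e' last_step by (intro disjI2 bexI[of _ e']) auto
    next
      case earlier_step
      then obtain e where e: "e \<in> E" "c \<in> ends e" "side E e c \<noteq> side E e y"
        using step.IH by blast
      then have "e \<noteq> e'" using e' earlier_step by auto
      then show ?thesis using e e'(3)[of e] by auto
    qed simp
  qed simp
  then show thesis using that assms by blast
qed

lemma separating_edge_unique:
  assumes "e \<in> E" "e' \<in> E" "c \<in> ends e" "c \<in> ends e'" "d \<in> V"
    and "side E e c \<noteq> side E e d" "side E e' c \<noteq> side E e' d"
  shows "e = e'"
proof (rule ccontr)
  assume ne: "e \<noteq> e'"
  then have same_side: "side E e' x = side E e' c" if "x \<in> ends e" for x
    using side_other_edge[OF assms(1), of e'] assms(3) that by auto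
  have same_side': "side E e x = side E e c" if "x \<in> ends e'" for x
    using side_other_edge[OF assms(2) ne] assms(4) that by auto
  have "(adj E)\<^sup>*\<^sup>* c d" using connected ends_subset assms by blast
  then have "side E e c = side E e d \<or> side E e' c = side E e' d"
  proof (induction rule: rtranclp_induct)
    case (step y z)
    obtain g where g: "g \<in> E" "g = (y, z) \<or> g = (z, y)"
        "\<And>h. h \<noteq> g \<Longrightarrow> side E h y = side E h z"
      using step.hyps(2) by (rule adj_edgeE) blast
    consider "g = e" | "g = e'" | (other) "g \<noteq> e" "g \<noteq> e'" by blast
    then show ?case
    proof cases
      case other
      then show ?thesis using step.IH g(3) by metis
    qed (use g same_side same_side' in auto)
  qed simp
  then show False using assms by blast
qed

text \<open>Every vertex other than a fixed root \<open>r\<close> is the far end, seen from \<open>r\<close>, of exactly one edge.\<close>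

lemma card_edges: "Suc (card E) = card V"
proof -
  obtain r where r: "r \<in> V" using V_nonempty by auto
  define away where "away e = (if side E e r then snd e else fst e)" for e
  have away: "away e \<in> ends e" "side E e (away e) \<noteq> side E e r" if "e \<in> E" for e
    using side_fst[of E e] not_side_snd[of e] that by (auto simp: away_def)
  have inj: "inj_on away E"
  proof (rule inj_onI)
    fix e e' assume "e \<in> E" "e' \<in> E" "away e = away e'"
    then show "e = e'"
      using separating_edge_unique[of e e' "away e" r] away[of e] away[of e'] r by simp
  qed
  have image: "away ` E = V - {r}"
  proof (intro equalityI subsetI)
    fix x assume "x \<in> away ` E"
    then obtain e where "x = away e" "e \<in> E" by (rule imageE)
    then show "x \<in> V - {r}" using away[of e] ends_subset[of e] by auto
  next
    fix x assume "x \<in> V - {r}"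
    then obtain e where e: "e \<in> E" "x \<in> ends e" "side E e x \<noteq> side E e r"
      using separating_edge[of x r] r by blast
    have "side E e x = side E e (away e)" using e(3) away(2)[OF e(1)] by simp
    then have "x = away e" using inj_onD[OF side_inj_on_ends] e away(1) by blast
    then show "x \<in> away ` E" using e(1) by (rule image_eqI)
  qed
  show ?thesis
    using card_image[OF inj] card_Suc_Diff1[OF finite_V r] unfolding image by simp
qed

definition side_card :: "'a \<times> 'a \<Rightarrow> bool \<Rightarrow> nat" where
  "side_card e b = card {x \<in> V. side E e x = b}"

lemma side_card_add: "side_card e True + side_card e False = card V"
  using card_filter_add_card_not[OF finite_V, of "side E e"] by (simp add: side_card_def)

lemma cut_system_sides: "cut_system V {(x, y). adj E x y} E (side E)"
proof
  show "{(x, y). adj E x y} \<subseteq> V \<times> V" using E_subset by (auto simp: adj_def)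
  show "\<exists>e. \<forall>e' \<in> E - {e}. side E e' y = side E e' x" if "(x, y) \<in> {(x, y). adj E x y}" for x y
  proof -
    have "adj E x y" using that by simp
    then show ?thesis by (rule adj_edgeE) blast
  qed
  show "\<exists>e \<in> E. \<exists>x'. (x, x') \<in> {(x, y). adj E x y} \<and> side E e x \<noteq> side E e y \<and> side E e x' \<noteq> side E e x"
    if xy: "x \<in> V" "y \<in> V" "x \<noteq> y" for x y
  proof -
    obtain e where e: "e \<in> E" "x \<in> ends e" "side E e x \<noteq> side E e y"
      using separating_edge[OF xy] .
    then obtain x' where "e = (x, x') \<or> e = (x', x)" by (cases e) auto
    then have "adj E x x'" "side E e x' \<noteq> side E e x"
      using e(1) side_fst[of E e] not_side_snd[OF e(1)] by (auto simp: adj_def)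
    then show ?thesis using e by blast
  qed
qed (fact finite_V finite_E)+

lemma wiener_tree:
  "wiener V {(x, y). adj E x y} = (\<Sum>e\<in>E. real (side_card e True) * real (side_card e False))"
  using cut_system.wiener_eq_sum_cuts[OF cut_system_sides] by (simp add: side_card_def separated_pairs_def)

lemma sum_sides_off_ends:
  fixes g :: "bool \<Rightarrow> real"
  assumes e: "e \<in> E"
  shows "(\<Sum>x\<in>V - ends e. g (side E e x)) =
    (real (side_card e True) - 1) * g True + (real (side_card e False) - 1) * g False"
proof -
  have part: "(\<Sum>x\<in>{x \<in> V - ends e. side E e x = b}. g (side E e x)) = (real (side_card e b) - 1) * g b"
    if x: "x \<in> ends e" "side E e x = b" for x b
  proof -
    have "{x \<in> V. side E e x = b} = insert x {x \<in> V - ends e. side E e x = b}"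
      using x ends_subset[OF e] side_inj_on_ends[OF e] by (auto simp: inj_on_def)
    then have "side_card e b = Suc (card {x \<in> V - ends e. side E e x = b})"
      using x(1) finite_V by (auto simp: side_card_def)
    then show ?thesis by simp
  qed
  have "(\<Sum>x\<in>V - ends e. g (side E e x)) = (\<Sum>x\<in>{x \<in> V - ends e. side E e x = True}. g (side E e x))
      + (\<Sum>x\<in>{x \<in> V - ends e. side E e x = False}. g (side E e x))"
    using finite_V by (subst sum.union_disjoint[symmetric]) (auto intro!: sum.cong)
  then show ?thesis
    using part[of "fst e" True] part[of "snd e" False] side_fst[of E e] not_side_snd[OF e]
    by (simp only: insertI1 insertI2 simp_thms)
qed

end

section \<open>Positions of words on cycles\<close>

definition half_circle :: "nat \<Rightarrow> nat \<Rightarrow> nat set" where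
  "half_circle M h = {h<..h + M}"

lemma mem_half_circle: "p \<in> half_circle M h \<longleftrightarrow> h < p \<and> p \<le> h + M"
  by (simp add: half_circle_def)

lemma half_circle_Suc:
  assumes "p < 2 * M" "h < M"
  shows "(Suc p mod (2 * M) \<in> half_circle M h) \<noteq> (p \<in> half_circle M h) \<longleftrightarrow> h = p mod M"
proof -
  have "p mod M = (if p < M then p else p - M)"
    using assms by (simp add: mod_if)
  then show ?thesis
    using assms by (cases "Suc p = 2 * M") (auto simp: mem_half_circle)
qed

lemma half_circle_separates:
  assumes "r < 2 * M" "q < 2 * M" and p: "p = Suc r mod (2 * M)" and "p \<noteq> q"
  shows "(p \<in> half_circle M (p mod M)) \<noteq> (q \<in> half_circle M (p mod M)) \<or>
    (p \<in> half_circle M (r mod M)) \<noteq> (q \<in> half_circle M (r mod M))"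
proof -
  have "r mod M = (if r < M then r else r - M)" and "p < 2 * M"
    using assms by (simp_all add: mod_if)
  moreover from this have "p mod M = (if p < M then p else p - M)"
    by (simp add: mod_if)
  moreover have "p = (if Suc r = 2 * M then 0 else Suc r)"
    using assms by auto
  ultimately show ?thesis
    using assms(1,2,4) by (auto simp: mem_half_circle)
qed

definition extreme_pos :: "bool \<Rightarrow> nat \<Rightarrow> nat" where
  "extreme_pos b m = of_bool b * (2 ^ m - 1)"

lemma extreme_pos_less: "extreme_pos b m < 2 ^ m"
  by (simp add: extreme_pos_def)

lemma extreme_pos_0 [simp]: "extreme_pos b 0 = 0"
  by (simp add: extreme_pos_def)

lemma extreme_pos_Suc: "extreme_pos b (Suc m) = of_bool b * 2 ^ m + extreme_pos b m"
  by (simp add: extreme_pos_def mult_2)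

lemma extreme_pos_mem_half_circle:
  assumes "h < 2 ^ j"
  shows "extreme_pos b (Suc j) \<in> half_circle (2 ^ j) h \<longleftrightarrow> b \<and> Suc h = 2 ^ j"
  using assms by (auto simp: extreme_pos_def mem_half_circle)

lemma length_edge_act [simp]: "length (edge_act e w) = length w"
  by (induction e w rule: edge_act.induct) auto

lemma edge_act_inverse: "s \<noteq> t \<Longrightarrow> edge_act (s, t) (edge_act (t, s) w) = w"
  by (induction w) auto

lemma set_edge_act: "set (edge_act (s, t) w) \<subseteq> set w \<union> {s, t}"
  by (induction w) auto

lemma edge_act_append:
  "v = [] \<or> hd v \<notin> {s, t} \<Longrightarrow> edge_act (s, t) (w @ v) = edge_act (s, t) w @ v"
proof (induction w)
  case Nil
  then show ?case by (cases v) auto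
qed auto

text \<open>
  Let \<open>A\<close> be the set of ends of an edge \<open>e = (s, t)\<close> and let \<open>f\<close> tell for each letter whether it lies
  on the side of \<open>s\<close>.  Words over \<open>A\<close> are binary numbers, least significant digit first, on which
  \<open>e\<close> acts by adding one.  An arbitrary word hangs off this cycle at the word obtained by replacing the
  prefix that ends in its last letter \<open>x \<notin> A\<close> by copies of the end of \<open>e\<close> on the side of \<open>x\<close>.
\<close>

primrec rev_word_pos :: "'a set \<Rightarrow> ('a \<Rightarrow> bool) \<Rightarrow> 'a list \<Rightarrow> nat" where
  "rev_word_pos A f [] = 0"
| "rev_word_pos A f (x # r) =
     (if x \<in> A then of_bool (f x) * 2 ^ length r + rev_word_pos A f r
      else extreme_pos (f x) (Suc (length r)))"

definition word_pos :: "'a set \<Rightarrow> ('a \<Rightarrow> bool) \<Rightarrow> 'a list \<Rightarrow> nat" where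
  "word_pos A f w = rev_word_pos A f (rev w)"

lemma word_pos_Nil [simp]: "word_pos A f [] = 0"
  by (simp add: word_pos_def)

lemma word_pos_snoc:
  "word_pos A f (w @ [x]) =
     (if x \<in> A then of_bool (f x) * 2 ^ length w + word_pos A f w
      else extreme_pos (f x) (Suc (length w)))"
  by (simp add: word_pos_def)

lemma word_pos_less: "word_pos A f w < 2 ^ length w"
proof (induction w rule: rev_induct)
  case (snoc x w)
  then show ?case using extreme_pos_less[of "f x" "Suc (length w)"] by (auto simp: word_pos_snoc)
qed simp

lemma word_pos_snoc_less_iff: "word_pos A f (w @ [x]) < 2 ^ length w \<longleftrightarrow> \<not> f x"
  using word_pos_less[of A f w] by (auto simp: word_pos_snoc extreme_pos_Suc extreme_pos_def)

lemma word_pos_append_cong: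
  assumes "word_pos A f p = word_pos A f q" "length p = length q"
  shows "word_pos A f (p @ v) = word_pos A f (q @ v)"
proof (induction v rule: rev_induct)
  case (snoc x v)
  then show ?case
    using assms word_pos_snoc[of A f "p @ v" x] word_pos_snoc[of A f "q @ v" x] by simp
qed (use assms in simp)

lemma word_pos_prefix_irrelevant:
  assumes "length p = length q" "z \<notin> A"
  shows "word_pos A f (p @ z # v) = word_pos A f (q @ z # v)"
  using word_pos_append_cong[of A f "p @ [z]" "q @ [z]" v] assms by (simp add: word_pos_snoc)

lemma word_pos_const:
  assumes "\<And>x. x \<in> set p \<Longrightarrow> f x = b"
  shows "word_pos A f p = extreme_pos b (length p)"
  using assms by (induction p rule: rev_induct) (auto simp: word_pos_snoc extreme_pos_Suc)

lemma word_pos_Cons: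
  assumes "set (x # p) \<subseteq> A"
  shows "word_pos A f (x # p) = of_bool (f x) + 2 * word_pos A f p"
  using assms
proof (induction p rule: rev_induct)
  case Nil
  then show ?case using word_pos_snoc[of A f "[]" x] by simp
next
  case (snoc y p)
  then show ?case using word_pos_snoc[of A f "x # p" y] word_pos_snoc[of A f p y] by simp
qed

lemma word_pos_eq_extremeD:
  assumes "set p \<subseteq> A" "word_pos A f p = extreme_pos b (length p)" "x \<in> set p"
  shows "f x = b"
  using assms
proof (induction p)
  case (Cons y p)
  have "of_bool (f y) + 2 * word_pos A f p = of_bool b + 2 * extreme_pos b (length p)"
    using Cons.prems by (simp add: word_pos_Cons extreme_pos_def diff_mult_distrib2)
  then have "f y = b \<and> word_pos A f p = extreme_pos b (length p)"
    by (cases "f y"; cases b) (simp_all, presburger+)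
  then show ?case using Cons by auto
qed simp

lemma word_pos_edge_act:
  assumes "set p \<subseteq> {s, t}" "f s" "\<not> f t"
  shows "word_pos {s, t} f (edge_act (s, t) p) = Suc (word_pos {s, t} f p) mod 2 ^ length p"
  using assms
proof (induction p)
  case (Cons x p)
  let ?pos = "word_pos {s, t} f"
  have act: "set (edge_act (s, t) p) \<subseteq> {s, t}"
    using set_edge_act[of s t p] Cons.prems by auto
  have "s \<noteq> t" using Cons.prems by auto
  then consider (carry) "x = s" | (no_carry) "x = t" "x \<noteq> s" using Cons.prems by auto
  then show ?case
  proof cases
    case carry
    then have "?pos (edge_act (s, t) (x # p)) = 2 * (Suc (?pos p) mod 2 ^ length p)"
      using Cons act by (simp add: word_pos_Cons)
    also have "\<dots> = Suc (?pos (x # p)) mod 2 ^ length (x # p)"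
      using carry Cons.prems by (simp add: word_pos_Cons mult_mod_right)
    finally show ?thesis .
  next
    case no_carry
    have act: "?pos (edge_act (s, t) (x # p)) = Suc (?pos (x # p))"
      using no_carry Cons.prems by (simp add: word_pos_Cons)
    also have "\<dots> < 2 ^ length (x # p)"
      using no_carry Cons.prems word_pos_less[of "{s, t}" f p] by (simp add: word_pos_Cons)
    finally show ?thesis
      using act by simp
  qed
qed simp

text \<open>
  The cycle with label \<open>e\<close> and common suffix \<open>\<tau>\<close> consists of the words \<open>p @ \<tau>\<close> with \<open>p\<close> over the
  two ends \<open>A\<close> of \<open>e\<close>.  Every word without suffix \<open>\<tau>\<close> hangs off this cycle at the constant word
  given by the side of \<open>e\<close> on which the first letter of \<open>\<tau>\<close> lies.
\<close>

definition cycle_pos :: "'a set \<Rightarrow> ('a \<Rightarrow> bool) \<Rightarrow> 'a list \<Rightarrow> 'a list \<Rightarrow> nat" where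
  "cycle_pos A f \<tau> w =
     (if suffix \<tau> w then word_pos A f (take (length w - length \<tau>) w)
      else extreme_pos (f (hd \<tau>)) (length w - length \<tau>))"

lemma cycle_pos_Nil [simp]: "cycle_pos A f [] w = word_pos A f w"
  by (simp add: cycle_pos_def)

lemma cycle_pos_append [simp]: "cycle_pos A f \<tau> (p @ \<tau>) = word_pos A f p"
  by (simp add: cycle_pos_def suffixI)

lemma cycle_pos_not_suffix:
  "\<not> suffix \<tau> w \<Longrightarrow> cycle_pos A f \<tau> w = extreme_pos (f (hd \<tau>)) (length w - length \<tau>)"
  by (simp add: cycle_pos_def)

lemma cycle_pos_append_append:
  "\<tau> \<noteq> [] \<Longrightarrow> cycle_pos A f (\<tau> @ v) (w @ v) = cycle_pos A f \<tau> w"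
  by (auto simp: cycle_pos_def)

lemma cycle_pos_less: "cycle_pos A f \<tau> w < 2 ^ (length w - length \<tau>)"
proof (cases "suffix \<tau> w")
  case True
  then obtain p where "w = p @ \<tau>" by (auto simp: suffix_def)
  then show ?thesis using word_pos_less[of A f p] by simp
qed (simp add: cycle_pos_not_suffix extreme_pos_less)

lemma cycle_pos_prefix_over_side:
  assumes f: "\<And>x. x \<in> B \<Longrightarrow> f x = b" and "set r \<subseteq> B" "\<not> suffix \<tau> v"
  shows "cycle_pos A f \<tau> (r @ v) = extreme_pos (f (hd \<tau>)) (length (r @ v) - length \<tau>)"
proof (cases "suffix \<tau> (r @ v)")
  case True
  with assms obtain r2 where \<tau>: "\<tau> = r2 @ v" and "suffix r2 r"
    by (auto simp: suffix_append)
  then obtain r1 where r: "r = r1 @ r2" by (auto simp: suffix_def)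
  have "r2 \<noteq> []" using assms(3) \<tau> by auto
  then have "hd \<tau> \<in> B" using \<open>set r \<subseteq> B\<close> r \<tau> by (cases r2) auto
  moreover have "word_pos A f r1 = extreme_pos b (length r1)"
    using \<open>set r \<subseteq> B\<close> r f by (intro word_pos_const) auto
  ultimately show ?thesis
    using cycle_pos_append[of A f \<tau> r1] r \<tau> f by simp
qed (simp add: cycle_pos_not_suffix)

lemma cycle_pos_replace_prefix:
  assumes f: "\<And>x. x \<in> B \<Longrightarrow> f x = b" and pq: "set p \<subseteq> B" "set q \<subseteq> B" "length p = length q"
  shows "cycle_pos A f \<tau> (p @ v) = cycle_pos A f \<tau> (q @ v)"
proof (cases "suffix \<tau> v")
  case True
  then obtain v' where v: "v = v' @ \<tau>" by (auto simp: suffix_def)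
  have "word_pos A f p = extreme_pos b (length p)" "word_pos A f q = extreme_pos b (length q)"
    using pq f by (intro word_pos_const; blast)+
  then have "word_pos A f (p @ v') = word_pos A f (q @ v')"
    using pq by (intro word_pos_append_cong) auto
  then show ?thesis
    using cycle_pos_append[of A f \<tau> "p @ v'"] cycle_pos_append[of A f \<tau> "q @ v'"] v by simp
next
  case False
  then show ?thesis
    using cycle_pos_prefix_over_side[of B f b p \<tau> v A] cycle_pos_prefix_over_side[of B f b q \<tau> v A]
      f pq by simp
qed

definition maximal_prefix :: "'a set \<Rightarrow> 'a list \<Rightarrow> 'a list \<Rightarrow> bool" where
  "maximal_prefix A p \<sigma> \<longleftrightarrow> set p \<subseteq> A \<and> (\<sigma> = [] \<or> hd \<sigma> \<notin> A)"

lemma obtain_maximal_prefix: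
  obtains p \<sigma> where "w = p @ \<sigma>" "maximal_prefix A p \<sigma>"
proof (rule that)
  show "w = takeWhile (\<lambda>x. x \<in> A) w @ dropWhile (\<lambda>x. x \<in> A) w" by simp
  show "maximal_prefix A (takeWhile (\<lambda>x. x \<in> A) w) (dropWhile (\<lambda>x. x \<in> A) w)"
    using hd_dropWhile[of "\<lambda>x. x \<in> A" w] by (auto simp: maximal_prefix_def dest: set_takeWhileD)
qed

lemma edge_act_maximal_prefix:
  assumes "maximal_prefix {s, t} p \<sigma>"
  shows "edge_act (s, t) (p @ \<sigma>) = edge_act (s, t) p @ \<sigma>"
    and "maximal_prefix {s, t} (edge_act (s, t) p) \<sigma>"
  using assms edge_act_append[of \<sigma> s t p] set_edge_act[of s t p]
  by (auto simp: maximal_prefix_def)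

lemma cycle_pos_edge_act_same_side:
  assumes "f s = f t"
  shows "cycle_pos A f \<tau> (edge_act (s, t) w) = cycle_pos A f \<tau> w"
proof -
  obtain p \<sigma> where w: "w = p @ \<sigma>" and p: "maximal_prefix {s, t} p \<sigma>"
    by (rule obtain_maximal_prefix)
  show ?thesis
    unfolding w edge_act_maximal_prefix(1)[OF p]
    using assms p edge_act_maximal_prefix(2)[OF p]
    by (intro cycle_pos_replace_prefix[where B = "{s, t}" and b = "f t"]) (auto simp: maximal_prefix_def)
qed

lemma cycle_pos_edge_act_own_cycle:
  assumes "maximal_prefix {s, t} p \<sigma>" "f s" "\<not> f t"
  shows "cycle_pos {s, t} f \<sigma> (edge_act (s, t) (p @ \<sigma>)) =
    Suc (cycle_pos {s, t} f \<sigma> (p @ \<sigma>)) mod 2 ^ length p"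
  using assms by (simp add: edge_act_maximal_prefix word_pos_edge_act maximal_prefix_def)

lemma cycle_pos_foreign_suffix:
  assumes "maximal_prefix A p \<sigma>" "maximal_prefix A q \<sigma>" "length p = length q"
    and \<tau>: "\<tau> = [] \<or> hd \<tau> \<notin> A" "\<tau> \<noteq> \<sigma>"
  shows "cycle_pos A f \<tau> (p @ \<sigma>) = cycle_pos A f \<tau> (q @ \<sigma>)"
proof (cases "suffix \<tau> \<sigma>")
  case True
  then obtain r where r: "\<sigma> = r @ \<tau>" by (auto simp: suffix_def)
  with \<tau>(2) obtain z r' where "r = z # r'" by (cases r) auto
  then have "z \<notin> A" using assms(1) r by (simp add: maximal_prefix_def)
  then show ?thesis
    using word_pos_prefix_irrelevant[OF assms(3)] r \<open>r = z # r'\<close>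
      cycle_pos_append[of A f \<tau> "p @ r"] cycle_pos_append[of A f \<tau> "q @ r"] by simp
next
  case False
  have "\<not> suffix \<tau> (r @ \<sigma>)" if "set r \<subseteq> A" for r
  proof
    assume "suffix \<tau> (r @ \<sigma>)"
    with False obtain r' where r': "\<tau> = r' @ \<sigma>" "suffix r' r" by (auto simp: suffix_append)
    then show False using \<tau> that set_mono_suffix[OF r'(2)] by (cases r') auto
  qed
  then show ?thesis
    using assms(1-3) by (simp add: cycle_pos_not_suffix maximal_prefix_def)
qed

lemma cycle_pos_edge_act_foreign_cycle:
  assumes "maximal_prefix {s, t} p \<sigma>" "\<tau> = [] \<or> hd \<tau> \<notin> {s, t}" "\<tau> \<noteq> \<sigma>"
  shows "cycle_pos {s, t} f \<tau> (edge_act (s, t) (p @ \<sigma>)) = cycle_pos {s, t} f \<tau> (p @ \<sigma>)"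
  using assms cycle_pos_foreign_suffix edge_act_maximal_prefix by (metis length_edge_act)

definition own_cycle_separates :: "'a set \<Rightarrow> ('a \<Rightarrow> bool) \<Rightarrow> 'a list \<Rightarrow> 'a list \<Rightarrow> bool" where
  "own_cycle_separates A f u v \<longleftrightarrow>
     (\<exists>p \<sigma>. u = p @ \<sigma> \<and> maximal_prefix A p \<sigma> \<and> cycle_pos A f \<sigma> u \<noteq> cycle_pos A f \<sigma> v)"

lemma own_cycle_separates_snoc:
  assumes "own_cycle_separates A f u v" "length u = length v"
  shows "own_cycle_separates A f (u @ [z]) (v @ [z])"
proof -
  obtain p \<sigma> where u: "u = p @ \<sigma>" and p: "maximal_prefix A p \<sigma>"
    and ne: "cycle_pos A f \<sigma> u \<noteq> cycle_pos A f \<sigma> v"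
    using assms(1) by (auto simp: own_cycle_separates_def)
  show ?thesis
  proof (cases "\<sigma> = [] \<and> z \<in> A")
    case True
    then have "cycle_pos A f [] (u @ [z]) \<noteq> cycle_pos A f [] (v @ [z])"
      using ne assms(2) by (simp add: word_pos_snoc)
    then show ?thesis
      unfolding own_cycle_separates_def using True p u
      by (intro exI[of _ "u @ [z]"] exI[of _ "[]"]) (simp add: maximal_prefix_def)
  next
    case False
    have "cycle_pos A f (\<sigma> @ [z]) (u @ [z]) \<noteq> cycle_pos A f (\<sigma> @ [z]) (v @ [z])"
      using ne cycle_pos_append[of A f "[z]"] cycle_pos_append_append[of \<sigma> A f "[z]"]
      by (cases "\<sigma> = []") auto
    then show ?thesis
      unfolding own_cycle_separates_def using False p u
      by (intro exI[of _ p] exI[of _ "\<sigma> @ [z]"]) (cases \<sigma>; simp add: maximal_prefix_def)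
  qed
qed

text \<open>
  The second word hangs off the own cycle of the first one at the constant word on the side of
  \<open>hd (\<sigma> @ [y])\<close>, unless both words lie on this cycle, in its two halves.
\<close>

lemma own_cycle_separates_if_last_differs:
  assumes u: "a @ [x] = p @ \<sigma>" and p: "maximal_prefix A p \<sigma>"
    and "length a = length b" "x \<noteq> y" "inj_on f A"
    and z: "z \<in> set p" "f z \<noteq> f (hd (\<sigma> @ [y]))"
  shows "own_cycle_separates A f (a @ [x]) (b @ [y])"
proof -
  have pA: "set p \<subseteq> A" using p by (simp add: maximal_prefix_def)
  have len: "length (b @ [y]) = length p + length \<sigma>"
    using arg_cong[OF u, of length] \<open>length a = length b\<close> by simp
  have "word_pos A f p \<noteq> extreme_pos (f (hd (\<sigma> @ [y]))) (length p)"
    using word_pos_eq_extremeD[OF pA _ z(1)] z(2) by blast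
  then have away: "cycle_pos A f \<sigma> (a @ [x]) \<noteq> extreme_pos (f (hd (\<sigma> @ [y]))) (length p)"
    by (simp add: u)
  consider (suffix) "\<sigma> \<noteq> []" | (outside) "\<sigma> = []" "y \<notin> A" | (halves) "\<sigma> = []" "y \<in> A" by blast
  then have "cycle_pos A f \<sigma> (a @ [x]) \<noteq> cycle_pos A f \<sigma> (b @ [y])"
  proof cases
    case suffix
    have "last \<sigma> = x" using arg_cong[OF u, of last] suffix by simp
    then have "\<not> suffix \<sigma> (b @ [y])"
      using suffix \<open>x \<noteq> y\<close> by (auto simp: suffix_def dest: arg_cong[of _ _ last])
    then have "cycle_pos A f \<sigma> (b @ [y]) = extreme_pos (f (hd \<sigma>)) (length p)"
      using len by (simp add: cycle_pos_not_suffix)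
    then show ?thesis using away suffix by simp
  next
    case outside
    then show ?thesis using away len by (simp add: word_pos_snoc)
  next
    case halves
    then have "x \<in> A" using u pA by auto
    then have "f x \<noteq> f y" using halves \<open>x \<noteq> y\<close> \<open>inj_on f A\<close> by (auto dest: inj_onD)
    then show ?thesis
      using halves word_pos_snoc_less_iff[of A f a x] word_pos_snoc_less_iff[of A f b y]
        \<open>length a = length b\<close> by auto
  qed
  then show ?thesis using u p unfolding own_cycle_separates_def by blast
qed

lemma obtain_first_other_letter:
  assumes "a @ [x] = c # w" "x \<noteq> y"
  obtains d where "d \<noteq> c" "d \<in> set (c # w @ [y])"
    "\<And>A p \<sigma>. c # w = p @ \<sigma> \<Longrightarrow> maximal_prefix A p \<sigma> \<Longrightarrow> c \<in> A \<Longrightarrow> d \<in> set p \<or> d = hd (\<sigma> @ [y])"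
proof -
  have "x \<in> set (c # w)" unfolding assms(1)[symmetric] by simp
  then have "\<exists>z \<in> set (c # w @ [y]). z \<noteq> c" using assms(2) by auto
  then obtain cs d r where d: "c # w @ [y] = cs @ d # r" "d \<noteq> c" "\<forall>z \<in> set cs. z = c"
    by (rule split_list_first_propE) blast
  have "d \<in> set p \<or> d = hd (\<sigma> @ [y])"
    if cw: "c # w = p @ \<sigma>" and p: "maximal_prefix A p \<sigma>" and "c \<in> A" for A p \<sigma>
  proof -
    have "cs @ d # r = (c # w) @ [y]" using d(1) by simp
    also have "\<dots> = p @ (\<sigma> @ [y])" unfolding cw by simp
    finally obtain q where
      "cs @ q = p \<and> d # r = q @ \<sigma> @ [y] \<or> cs = p @ q \<and> q @ d # r = \<sigma> @ [y]"
      unfolding append_eq_append_conv2 by blast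
    then consider (in_prefix) "cs @ q = p" "d # r = q @ \<sigma> @ [y]"
      | (after_prefix) "q \<noteq> []" "cs = p @ q" "q @ d # r = \<sigma> @ [y]"
      by (cases "q = []") auto
    then show ?thesis
    proof cases
      case in_prefix
      have "d = hd (q @ \<sigma> @ [y])" using in_prefix(2) by (metis list.sel(1))
      then show ?thesis using in_prefix(1) by (cases q) auto
    next
      case after_prefix
      then have "hd (\<sigma> @ [y]) = hd q" by (metis hd_append2)
      then have "hd (\<sigma> @ [y]) = c" using after_prefix d(3) by simp
      then have "\<sigma> = []" using p \<open>c \<in> A\<close> by (cases \<sigma>) (auto simp: maximal_prefix_def)
      then show ?thesis using after_prefix by (cases q) auto
    qed
  qed
  then show thesis using d by (intro that[of d]) auto
qed

section \<open>The cuts of the Schreier graph\<close>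

context tree_graph
begin

abbreviation edge_cycle_pos :: "'a \<times> 'a \<Rightarrow> 'a list \<Rightarrow> 'a list \<Rightarrow> nat" where
  "edge_cycle_pos e \<equiv> cycle_pos (ends e) (side E e)"

definition cycle_suffixes :: "'a \<times> 'a \<Rightarrow> nat \<Rightarrow> 'a list set" where
  "cycle_suffixes e i = {\<tau> \<in> words V i. \<tau> = [] \<or> hd \<tau> \<notin> ends e}"

definition cut_index :: "nat \<Rightarrow> (('a \<times> 'a) \<times> nat \<times> 'a list \<times> nat) set" where
  "cut_index n = (SIGMA e:E. SIGMA j:{..<n}. SIGMA \<tau>:cycle_suffixes e (n - Suc j). {..<2 ^ j})"

text \<open>
  The cycle \<open>(e, \<tau>)\<close> has length \<open>2 * 2 ^ j\<close>; its cut \<open>h\<close> splits it into two paths by removing the edges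
  from \<open>h\<close> to \<open>h + 1\<close> and from \<open>h + 2 ^ j\<close> to \<open>h + 2 ^ j + 1\<close> (modulo the length).
\<close>

fun schreier_cut :: "('a \<times> 'a) \<times> nat \<times> 'a list \<times> nat \<Rightarrow> 'a list \<Rightarrow> bool" where
  "schreier_cut (e, j, \<tau>, h) u \<longleftrightarrow> edge_cycle_pos e \<tau> u \<in> half_circle (2 ^ j) h"

lemma finite_words: "finite (words V n)"
  using finite_lists_length_eq[OF finite_V, of n] by (simp add: words_def conj_commute)

lemma finite_cut_index: "finite (cut_index n)"
  using finite_E finite_words by (auto simp: cut_index_def cycle_suffixes_def)

lemma edge_act_words:
  assumes "e \<in> E" "u \<in> words V n"
  shows "edge_act e u \<in> words V n" "edge_act (prod.swap e) u \<in> words V n"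
  using assms set_edge_act[of "fst e" "snd e" u] set_edge_act[of "snd e" "fst e" u] ends_subset[of e]
  by (auto simp: words_def prod.swap_def)

lemma edge_act_swap: "e \<in> E \<Longrightarrow> edge_act e (edge_act (prod.swap e) u) = u"
  using edge_act_inverse[of "fst e" "snd e" u] edge_neq[of e] by (simp add: prod.swap_def)

lemma edge_cycle_pos_own:
  assumes "e \<in> E" "maximal_prefix (ends e) p \<sigma>"
  shows "edge_cycle_pos e \<sigma> (edge_act e (p @ \<sigma>)) =
    Suc (edge_cycle_pos e \<sigma> (p @ \<sigma>)) mod 2 ^ length p"
  using cycle_pos_edge_act_own_cycle[of "fst e" "snd e" p \<sigma> "side E e"] assms
    side_fst[of E e] not_side_snd[OF assms(1)] by simp

lemma edge_cycle_pos_other: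
  assumes "e \<in> E" "maximal_prefix (ends e) p \<sigma>" "\<tau> = [] \<or> hd \<tau> \<notin> ends e'" "(e', \<tau>) \<noteq> (e, \<sigma>)"
  shows "edge_cycle_pos e' \<tau> (edge_act e (p @ \<sigma>)) = edge_cycle_pos e' \<tau> (p @ \<sigma>)"
proof (cases "e' = e")
  case True
  then show ?thesis
    using assms cycle_pos_edge_act_foreign_cycle[of "fst e" "snd e" p \<sigma> \<tau> "side E e"] by simp
next
  case False
  then show ?thesis
    using cycle_pos_edge_act_same_side[of "side E e'" "fst e" "snd e"] side_other_edge[OF assms(1) False]
    by simp
qed

lemma schreier_cut_edge_act_iff:
  assumes e: "e \<in> E" and p: "maximal_prefix (ends e) p \<sigma>" and "length (p @ \<sigma>) = n"
    and i: "(e', j, \<tau>, h) \<in> cut_index n"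
  shows "schreier_cut (e', j, \<tau>, h) (edge_act e (p @ \<sigma>)) \<noteq> schreier_cut (e', j, \<tau>, h) (p @ \<sigma>)
    \<longleftrightarrow> (e', \<tau>) = (e, \<sigma>) \<and> h = edge_cycle_pos e \<sigma> (p @ \<sigma>) mod 2 ^ j"
proof (cases "(e', \<tau>) = (e, \<sigma>)")
  case True
  have "length p = Suc j" "h < 2 ^ j"
    using i True \<open>length (p @ \<sigma>) = n\<close> by (auto simp: cut_index_def cycle_suffixes_def words_def)
  moreover from this have "edge_cycle_pos e \<sigma> (p @ \<sigma>) < 2 * 2 ^ j"
    using cycle_pos_less[of "ends e" "side E e" \<sigma> "p @ \<sigma>"] by simp
  ultimately show ?thesis
    using True half_circle_Suc edge_cycle_pos_own[OF e p] by simp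
next
  case False
  moreover have "\<tau> = [] \<or> hd \<tau> \<notin> ends e'"
    using i by (auto simp: cut_index_def cycle_suffixes_def)
  ultimately show ?thesis using edge_cycle_pos_other[OF e p] by auto
qed

lemma schreier_step_crosses_one:
  assumes "(u, v) \<in> schreier_rel V E n"
  shows "\<exists>i. \<forall>i' \<in> cut_index n - {i}. schreier_cut i' v = schreier_cut i' u"
proof -
  have act: "\<exists>i. \<forall>i' \<in> cut_index n - {i}. schreier_cut i' (edge_act e w) = schreier_cut i' w"
    if e: "e \<in> E" and w: "w \<in> words V n" for e w
  proof -
    obtain p \<sigma> where p: "w = p @ \<sigma>" "maximal_prefix (ends e) p \<sigma>"
      by (rule obtain_maximal_prefix)
    define j where "j = n - Suc (length \<sigma>)"
    have "schreier_cut i' (edge_act e w) = schreier_cut i' w"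
      if i': "i' \<in> cut_index n - {(e, j, \<sigma>, edge_cycle_pos e \<sigma> w mod 2 ^ j)}" for i'
    proof -
      obtain e' j' \<tau> h where i'_eq: "i' = (e', j', \<tau>, h)" by (cases i')
      have "j' = n - Suc (length \<tau>)"
        using i' by (auto simp: i'_eq cut_index_def cycle_suffixes_def words_def)
      then show ?thesis
        using schreier_cut_edge_act_iff[OF e p(2), of n e' j' \<tau> h] i' w p(1)
        by (auto simp: i'_eq j_def words_def simp del: schreier_cut.simps)
    qed
    then show ?thesis by blast
  qed
  obtain e where e: "e \<in> E" "u \<in> words V n" "v \<in> words V n" "v = edge_act e u \<or> u = edge_act e v"
    using assms by (auto simp: schreier_rel_def)
  then show ?thesis using act[OF e(1,2)] act[OF e(1,3)] by metis
qed

lemma words_separated_if_last_differs: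
  assumes "a @ [x] \<in> words V n" "y \<in> V" "length a = length b" "x \<noteq> y"
  shows "\<exists>e \<in> E. own_cycle_separates (ends e) (side E e) (a @ [x]) (b @ [y])"
proof -
  obtain c w where u: "a @ [x] = c # w" by (cases "a @ [x]") auto
  obtain d where d: "d \<noteq> c" "d \<in> set (c # w @ [y])"
    and d_cases: "\<And>A p \<sigma>. c # w = p @ \<sigma> \<Longrightarrow> maximal_prefix A p \<sigma> \<Longrightarrow> c \<in> A \<Longrightarrow>
      d \<in> set p \<or> d = hd (\<sigma> @ [y])"
    using obtain_first_other_letter[OF u assms(4)] by blast
  have "c \<in> V" "d \<in> V" using assms(1,2) d(2) by (auto simp: u words_def)
  then obtain e where e: "e \<in> E" "c \<in> ends e" "side E e c \<noteq> side E e d"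
    using separating_edge d(1) by metis
  obtain p \<sigma> where p: "c # w = p @ \<sigma>" "maximal_prefix (ends e) p \<sigma>"
    by (rule obtain_maximal_prefix)
  have "c \<in> set p" using p e(2) by (cases p) (auto simp: maximal_prefix_def)
  then obtain z where z: "z \<in> set p" "side E e z \<noteq> side E e (hd (\<sigma> @ [y]))"
    using d_cases[OF p e(2)] e(3) by metis
  have "own_cycle_separates (ends e) (side E e) (a @ [x]) (b @ [y])"
    using u p(1) own_cycle_separates_if_last_differs[OF _ p(2) assms(3,4) side_inj_on_ends[OF e(1)] z]
    by simp
  then show ?thesis using e(1) by blast
qed

lemma words_separated:
  assumes "u \<in> words V n" "v \<in> words V n" "u \<noteq> v"
  shows "\<exists>e \<in> E. own_cycle_separates (ends e) (side E e) u v"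
  using assms
proof (induction n arbitrary: u v)
  case (Suc n)
  obtain a x where u: "u = a @ [x]" using Suc.prems(1) by (cases u rule: rev_cases) (auto simp: words_def)
  obtain b y where v: "v = b @ [y]" using Suc.prems(2) by (cases v rule: rev_cases) (auto simp: words_def)
  have ab: "a \<in> words V n" "b \<in> words V n" "y \<in> V" "length a = length b"
    using Suc.prems by (auto simp: u v words_def)
  show ?case
  proof (cases "x = y")
    case True
    then have "\<exists>e \<in> E. own_cycle_separates (ends e) (side E e) a b"
      using Suc u v ab by blast
    then show ?thesis using own_cycle_separates_snoc[OF _ ab(4)] u v True by blast
  next
    case False
    then show ?thesis using words_separated_if_last_differs Suc.prems(1) u v ab by blast
  qed
qed (simp add: words_def)

lemma own_cycle_cut_index:
  assumes "e \<in> E" "maximal_prefix (ends e) p \<sigma>" "p @ \<sigma> \<in> words V n" "length p = Suc j" "h < 2 ^ j"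
  shows "(e, j, \<sigma>, h) \<in> cut_index n"
  using assms by (auto simp: cut_index_def cycle_suffixes_def maximal_prefix_def words_def)

lemma schreier_cut_edge_act:
  assumes "e \<in> E" "maximal_prefix (ends e) p \<sigma>" "p @ \<sigma> \<in> words V n" "length p = Suc j"
  defines "i \<equiv> (e, j, \<sigma>, edge_cycle_pos e \<sigma> (p @ \<sigma>) mod 2 ^ j)"
  shows "schreier_cut i (edge_act e (p @ \<sigma>)) \<noteq> schreier_cut i (p @ \<sigma>)"
proof -
  have "i \<in> cut_index n" unfolding i_def using assms(1-4) by (rule own_cycle_cut_index) simp
  moreover have "length (p @ \<sigma>) = n" using assms(3) by (simp add: words_def)
  ultimately show ?thesis
    using schreier_cut_edge_act_iff[OF assms(1,2)] unfolding i_def by blast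
qed

lemma schreier_crossing_step:
  assumes u: "u \<in> words V n" and v: "v \<in> words V n" and "u \<noteq> v"
  shows "\<exists>i \<in> cut_index n. \<exists>u'. (u, u') \<in> schreier_rel V E n \<and>
    schreier_cut i u \<noteq> schreier_cut i v \<and> schreier_cut i u' \<noteq> schreier_cut i u"
proof -
  obtain e p \<sigma> where e: "e \<in> E" and p: "u = p @ \<sigma>" "maximal_prefix (ends e) p \<sigma>"
    and ne: "edge_cycle_pos e \<sigma> u \<noteq> edge_cycle_pos e \<sigma> v"
    using words_separated[OF assms] by (auto simp: own_cycle_separates_def)
  define p' where "p' = edge_act (prod.swap e) p"
  have p': "edge_act (prod.swap e) u = p' @ \<sigma>" "maximal_prefix (ends e) p' \<sigma>"
    using edge_act_maximal_prefix[of "snd e" "fst e" p \<sigma>] p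
    by (simp_all add: p'_def prod.swap_def insert_commute)
  have act: "edge_act e (p' @ \<sigma>) = u" using edge_act_swap[OF e] by (simp flip: p'(1))
  have words: "p' @ \<sigma> \<in> words V n" "edge_act e u \<in> words V n"
    using edge_act_words[OF e u] by (simp_all flip: p'(1))
  have bound: "edge_cycle_pos e \<sigma> w < 2 ^ length p" if "w \<in> words V n" for w
  proof -
    have "length w = length p + length \<sigma>" using that u p(1) by (simp add: words_def)
    then show ?thesis using cycle_pos_less[of "ends e" "side E e" \<sigma> w] by simp
  qed
  have "p \<noteq> []" using ne bound[OF u] bound[OF v] by auto
  then obtain j where j: "length p = Suc j" "length p' = Suc j" by (cases p) (auto simp: p'_def)
  let ?pos = "edge_cycle_pos e \<sigma>"
  let ?next = "(e, j, \<sigma>, ?pos u mod 2 ^ j)" and ?prev = "(e, j, \<sigma>, ?pos (p' @ \<sigma>) mod 2 ^ j)"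
  have succ: "?pos u = Suc (?pos (p' @ \<sigma>)) mod (2 * 2 ^ j)"
    using edge_cycle_pos_own[OF e p'(2)] unfolding act j(2) by simp
  have separated: "schreier_cut ?next u \<noteq> schreier_cut ?next v \<or> schreier_cut ?prev u \<noteq> schreier_cut ?prev v"
    using half_circle_separates[OF _ _ succ ne] bound[OF words(1)] bound[OF v] j(1) by simp
  have cross_next: "schreier_cut ?next (edge_act e u) \<noteq> schreier_cut ?next u"
    using schreier_cut_edge_act[OF e p(2) _ j(1)] u unfolding p(1) by blast
  have cross_prev: "schreier_cut ?prev (p' @ \<sigma>) \<noteq> schreier_cut ?prev u"
    using schreier_cut_edge_act[OF e p'(2) words(1) j(2)] unfolding act by (rule not_sym)
  have "(u, edge_act e u) \<in> schreier_rel V E n" "(u, p' @ \<sigma>) \<in> schreier_rel V E n"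
    using e u words act unfolding schreier_rel_def by blast+
  moreover have "?next \<in> cut_index n" "?prev \<in> cut_index n"
    using own_cycle_cut_index[OF e p(2) _ j(1)] u p(1) by simp_all
  ultimately show ?thesis using separated cross_next cross_prev by blast
qed

lemma cut_system_schreier:
  "cut_system (words V n) (schreier_rel V E n) (cut_index n) schreier_cut"
proof
  show "schreier_rel V E n \<subseteq> words V n \<times> words V n" by (auto simp: schreier_rel_def)
qed (fact finite_words finite_cut_index schreier_step_crosses_one schreier_crossing_step)+

end

section \<open>Counting the words on the sides of the cuts\<close>

lemma word_pos_snoc_mem_half_circle:
  assumes "h < 2 ^ length w"
  shows "word_pos A f (w @ [x]) \<in> half_circle (2 ^ length w) h \<longleftrightarrow>
    (if x \<in> A then f x \<noteq> (h < word_pos A f w) else f x \<and> Suc h = 2 ^ length w)"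
proof (cases "x \<in> A")
  case True
  then show ?thesis
    using assms word_pos_less[of A f w] by (auto simp: word_pos_snoc mem_half_circle)
next
  case False
  then show ?thesis
    by (simp only: word_pos_snoc if_False extreme_pos_mem_half_circle[OF assms])
qed

definition cycle_pairs :: "real \<Rightarrow> nat \<Rightarrow> nat \<Rightarrow> real \<Rightarrow> real" where
  "cycle_pairs k n j d = (2 ^ j - 1) * (k ^ j * (k ^ n - k ^ j)) + k ^ j * d * (k ^ n - k ^ j * d)"

context tree_graph
begin

lemma card_words: "card (words V n) = card V ^ n"
  using card_lists_length_eq[OF finite_V, of n] by (simp add: words_def conj_commute)

lemma card_words_snoc:
  "card {u \<in> words V (Suc m). P u} = (\<Sum>w\<in>words V m. card {x \<in> V. P (w @ [x])})"
proof -
  let ?W = "SIGMA w:words V m. {x \<in> V. P (w @ [x])}"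
  have "{u \<in> words V (Suc m). P u} = (\<lambda>(w, x). w @ [x]) ` ?W"
  proof (intro equalityI subsetI)
    fix u assume "u \<in> {u \<in> words V (Suc m). P u}"
    then show "u \<in> (\<lambda>(w, x). w @ [x]) ` ?W"
      by (cases u rule: rev_cases) (auto simp: words_def)
  qed (auto simp: words_def)
  moreover have "inj_on (\<lambda>(w, x). w @ [x]) ?W" by (auto simp: inj_on_def)
  ultimately have "card {u \<in> words V (Suc m). P u} = card ?W" by (simp add: card_image)
  then show ?thesis using finite_words finite_V by (simp add: card_SigmaI)
qed

lemma card_far_last_letters:
  assumes e: "e \<in> E" and "h < 2 ^ length w"
  shows "card {x \<in> V. (word_pos (ends e) (side E e) (w @ [x]) \<in> half_circle (2 ^ length w) h)
      \<noteq> (b \<and> Suc h = 2 ^ length w)} =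
    (if Suc h = 2 ^ length w then side_card e (\<not> b) else 1)"
proof (cases "Suc h = 2 ^ length w")
  case True
  then have "\<not> h < word_pos (ends e) (side E e) w"
    using word_pos_less[of "ends e" "side E e" w] by simp
  then have "word_pos (ends e) (side E e) (w @ [x]) \<in> half_circle (2 ^ length w) h \<longleftrightarrow> side E e x" for x
    unfolding word_pos_snoc_mem_half_circle[OF assms(2)] using True by simp
  then show ?thesis using True by (simp add: side_card_def)
next
  case False
  define x where "x = (if h < word_pos (ends e) (side E e) w then snd e else fst e)"
  have "{y \<in> V. word_pos (ends e) (side E e) (w @ [y]) \<in> half_circle (2 ^ length w) h} = {x}"
    using False side_fst[of E e] not_side_snd[OF e] ends_subset[OF e]
    by (auto simp: word_pos_snoc_mem_half_circle[OF assms(2)] x_def split: if_splits)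
  then show ?thesis using False by simp
qed

text \<open>
  All words without suffix \<open>\<tau>\<close> lie on the same side of the cut, so the far side consists of words
  \<open>w @ [x] @ \<tau>\<close>, and the number of admissible letters \<open>x\<close> does not depend on \<open>w\<close>.
\<close>

lemma card_far_side:
  assumes i: "(e, j, \<tau>, h) \<in> cut_index n"
  shows "card {u \<in> words V n. schreier_cut (e, j, \<tau>, h) u \<noteq> (side E e (hd \<tau>) \<and> Suc h = 2 ^ j)} =
    card V ^ j * (if Suc h = 2 ^ j then side_card e (\<not> side E e (hd \<tau>)) else 1)"
proof -
  have e: "e \<in> E" and h: "h < 2 ^ j" and \<tau>: "\<tau> \<in> words V (n - Suc j)" and "j < n"
    using i by (auto simp: cut_index_def cycle_suffixes_def)
  then have n: "n = Suc j + length \<tau>" by (simp add: words_def)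
  let ?b = "side E e (hd \<tau>)"
  let ?far = "\<lambda>p. (word_pos (ends e) (side E e) p \<in> half_circle (2 ^ j) h) \<noteq> (?b \<and> Suc h = 2 ^ j)"
  have not_far: "schreier_cut (e, j, \<tau>, h) u = (?b \<and> Suc h = 2 ^ j)"
    if "u \<in> words V n" "\<not> suffix \<tau> u" for u
    using that n extreme_pos_mem_half_circle[OF h, of ?b] by (simp add: cycle_pos_not_suffix words_def)
  have "{u \<in> words V n. schreier_cut (e, j, \<tau>, h) u \<noteq> (?b \<and> Suc h = 2 ^ j)} =
      (\<lambda>p. p @ \<tau>) ` {p \<in> words V (Suc j). ?far p}"
  proof (intro equalityI subsetI)
    fix u assume u: "u \<in> {u \<in> words V n. schreier_cut (e, j, \<tau>, h) u \<noteq> (?b \<and> Suc h = 2 ^ j)}"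
    then obtain p where "u = p @ \<tau>" using not_far by (auto simp: suffix_def)
    then show "u \<in> (\<lambda>p. p @ \<tau>) ` {p \<in> words V (Suc j). ?far p}"
      using u n by (auto simp: words_def)
  qed (use n \<tau> in \<open>auto simp: words_def\<close>)
  then have "card {u \<in> words V n. schreier_cut (e, j, \<tau>, h) u \<noteq> (?b \<and> Suc h = 2 ^ j)} =
      card {p \<in> words V (Suc j). ?far p}"
    by (simp add: card_image inj_on_def)
  also have "\<dots> = (\<Sum>w\<in>words V j. if Suc h = 2 ^ j then side_card e (\<not> ?b) else 1)"
    unfolding card_words_snoc
  proof (rule sum.cong[OF refl])
    fix w assume "w \<in> words V j"
    then have "length w = j" by (simp add: words_def)
    then show "card {x \<in> V. ?far (w @ [x])} = (if Suc h = 2 ^ j then side_card e (\<not> ?b) else 1)"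
      using card_far_last_letters[OF e, of h w ?b] h by simp
  qed
  finally show ?thesis by (simp add: card_words)
qed

lemma sum_cycle_cuts:
  assumes "e \<in> E" "j < n" "\<tau> \<in> cycle_suffixes e (n - Suc j)"
  shows "(\<Sum>h<2 ^ j. separated_pairs (words V n) (schreier_cut (e, j, \<tau>, h))) =
    cycle_pairs (card V) n j (side_card e (\<not> side E e (hd \<tau>)))"
proof -
  let ?d = "\<lambda>h. if Suc h = 2 ^ j then side_card e (\<not> side E e (hd \<tau>)) else 1"
  have pairs: "separated_pairs (words V n) (schreier_cut (e, j, \<tau>, h)) =
      real (card V) ^ j * ?d h * (real (card V) ^ n - real (card V) ^ j * ?d h)" if "h < 2 ^ j" for h
  proof -
    have i: "(e, j, \<tau>, h) \<in> cut_index n" using assms that by (simp add: cut_index_def)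
    show ?thesis
      unfolding separated_pairs_eq[OF finite_words, of _ _ "side E e (hd \<tau>) \<and> Suc h = 2 ^ j"]
        card_far_side[OF i] by (simp add: card_words)
  qed
  obtain m where m: "2 ^ j = Suc m" by (metis not0_implies_Suc power_not_zero zero_neq_numeral)
  then have "real m = 2 ^ j - 1"
    by (metis add_diff_cancel_left' of_nat_Suc of_nat_numeral of_nat_power)
  then show ?thesis using pairs unfolding m by (simp add: cycle_pairs_def)
qed

lemma sum_cycle_suffixes:
  fixes g :: "bool \<Rightarrow> real"
  assumes e: "e \<in> E"
  shows "(\<Sum>\<tau>\<in>cycle_suffixes e (Suc i). g (side E e (hd \<tau>))) = real (card V) ^ i *
    ((real (side_card e True) - 1) * g True + (real (side_card e False) - 1) * g False)"
proof -
  have "cycle_suffixes e (Suc i) = (\<lambda>(x, w). x # w) ` ((V - ends e) \<times> words V i)"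
  proof (intro equalityI subsetI)
    fix \<tau> assume "\<tau> \<in> cycle_suffixes e (Suc i)"
    then show "\<tau> \<in> (\<lambda>(x, w). x # w) ` ((V - ends e) \<times> words V i)"
      by (cases \<tau>) (auto simp: cycle_suffixes_def words_def)
  qed (auto simp: cycle_suffixes_def words_def)
  moreover have "inj_on (\<lambda>(x, w). x # w) ((V - ends e) \<times> words V i)" by (auto simp: inj_on_def)
  ultimately have "(\<Sum>\<tau>\<in>cycle_suffixes e (Suc i). g (side E e (hd \<tau>))) =
      (\<Sum>(x, w)\<in>(V - ends e) \<times> words V i. g (side E e x))"
    by (simp add: sum.reindex case_prod_unfold)
  also have "\<dots> = real (card V) ^ i * (\<Sum>x\<in>V - ends e. g (side E e x))"
    by (simp add: card_words sum_distrib_left flip: sum.cartesian_product)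
  finally show ?thesis by (simp add: sum_sides_off_ends[OF e])
qed

lemma cycle_suffixes_0: "cycle_suffixes e 0 = {[]}"
  by (auto simp: cycle_suffixes_def words_def)

lemma wiener_schreier_sum_cycles:
  "wiener (words V n) (schreier_rel V E n) =
    (\<Sum>e\<in>E. \<Sum>j<n. \<Sum>\<tau>\<in>cycle_suffixes e (n - Suc j).
      cycle_pairs (card V) n j (side_card e (\<not> side E e (hd \<tau>))))"
proof -
  have fin: "finite (cycle_suffixes e i)" for e i
    using finite_words by (simp add: cycle_suffixes_def)
  have "wiener (words V n) (schreier_rel V E n) =
      (\<Sum>i\<in>cut_index n. separated_pairs (words V n) (schreier_cut i))"
    by (rule cut_system.wiener_eq_sum_cuts[OF cut_system_schreier])
  also have "\<dots> = (\<Sum>e\<in>E. \<Sum>j<n. \<Sum>\<tau>\<in>cycle_suffixes e (n - Suc j). \<Sum>h<2 ^ j.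
      separated_pairs (words V n) (schreier_cut (e, j, \<tau>, h)))"
    unfolding cut_index_def using finite_E fin by (simp add: sum.Sigma case_prod_unfold)
  also have "\<dots> = (\<Sum>e\<in>E. \<Sum>j<n. \<Sum>\<tau>\<in>cycle_suffixes e (n - Suc j).
      cycle_pairs (card V) n j (side_card e (\<not> side E e (hd \<tau>))))"
    by (intro sum.cong refl sum_cycle_cuts) auto
  finally show ?thesis .
qed

end

section \<open>The closed form\<close>

definition edge_contribution :: "nat \<Rightarrow> real \<Rightarrow> real \<Rightarrow> real" where
  "edge_contribution N a b = (let k = a + b; n = Suc N in cycle_pairs k n N a +
     (\<Sum>j<N. k ^ (N - Suc j) * ((a - 1) * cycle_pairs k n j b + (b - 1) * cycle_pairs k n j a)))"

text \<open>For the empty suffix \<open>hd \<tau>\<close> is unspecified, but both sides of \<open>e\<close> lead to the same sum.\<close>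

lemma cycle_pairs_top: "cycle_pairs (a + b) (Suc N) N b = cycle_pairs (a + b) (Suc N) N a"
  by (simp add: cycle_pairs_def algebra_simps)

lemma (in tree_graph) wiener_schreier_sum_edges:
  "wiener (words V (Suc N)) (schreier_rel V E (Suc N)) =
    (\<Sum>e\<in>E. edge_contribution N (side_card e True) (side_card e False))"
  unfolding wiener_schreier_sum_cycles
proof (rule sum.cong[OF refl])
  fix e assume e: "e \<in> E"
  let ?a = "real (side_card e True)" and ?b = "real (side_card e False)"
  have k: "real (card V) = ?a + ?b" using side_card_add[of e] by (simp flip: of_nat_add)
  define g where "g j c = cycle_pairs (card V) (Suc N) j (side_card e (\<not> c))" for j c
  have top: "g N c = cycle_pairs (card V) (Suc N) N ?a" for c
    using cycle_pairs_top[of ?a ?b N] by (cases c) (simp_all add: g_def k)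
  have "(\<Sum>j<Suc N. \<Sum>\<tau>\<in>cycle_suffixes e (Suc N - Suc j). g j (side E e (hd \<tau>))) =
      g N (side E e (hd [])) + (\<Sum>j<N. \<Sum>\<tau>\<in>cycle_suffixes e (Suc (N - Suc j)). g j (side E e (hd \<tau>)))"
    by (simp add: cycle_suffixes_0 Suc_diff_Suc)
  also have "\<dots> = edge_contribution N ?a ?b"
    unfolding top sum_cycle_suffixes[OF e] by (simp add: edge_contribution_def Let_def g_def k)
  finally show "(\<Sum>j<Suc N. \<Sum>\<tau>\<in>cycle_suffixes e (Suc N - Suc j).
      cycle_pairs (card V) (Suc N) j (side_card e (\<not> side E e (hd \<tau>)))) = edge_contribution N ?a ?b"
    by (simp add: g_def)
qed

lemma level_contribution_eq:
  fixes a b :: real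
  assumes "j < N" "a + b = k" "k > 0"
  shows "k ^ (N - Suc j) * ((a - 1) * cycle_pairs k (Suc N) j b + (b - 1) * cycle_pairs k (Suc N) j a) =
    k ^ N / k * ((k - 2) * k * k ^ N * 2 ^ j - (k - 2) * (2 * k) ^ j
      + (k\<^sup>2 + k - 2 - (k + 2) * (a * b)) * k ^ j + 2 * k * k ^ N * (a * b - k + 1))"
    (is "_ = k ^ N / k * ?r")
proof -
  have "k ^ N = k ^ (N - Suc j) * (k ^ j * k)"
    using \<open>j < N\<close> by (metis Suc_leI le_add_diff_inverse2 power_Suc2 power_add)
  then have power: "k ^ (N - Suc j) * k ^ j = k ^ N / k" using \<open>k > 0\<close> by simp
  have "(a - 1) * cycle_pairs k (Suc N) j b + (b - 1) * cycle_pairs k (Suc N) j a = k ^ j * ?r"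
    unfolding cycle_pairs_def power_mult_distrib \<open>a + b = k\<close>[symmetric] by (simp, algebra)
  then show ?thesis by (simp only: power flip: mult.assoc)
qed

lemma edge_contribution_geometric:
  fixes a b k :: real and N :: nat
  assumes "a + b = k" "k > 1"
  defines "K \<equiv> k ^ N" and "T \<equiv> 2 ^ N"
  shows "edge_contribution N a b = (T - 1) * (K * (k * K - K)) + K\<^sup>2 * (a * b) +
    K / k * ((k - 2) * k * K * (T - 1) - (k - 2) * ((T * K - 1) / (2 * k - 1))
      + (k\<^sup>2 + k - 2 - (k + 2) * (a * b)) * ((K - 1) / (k - 1)) + N * (2 * k * K * (a * b - k + 1)))"
proof -
  let ?S = "\<Sum>j<N. k ^ (N - Suc j) *
    ((a - 1) * cycle_pairs k (Suc N) j b + (b - 1) * cycle_pairs k (Suc N) j a)"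
  have nz: "k \<noteq> 1" "2 * k \<noteq> 1" using \<open>k > 1\<close> by auto
  have "?S = (\<Sum>j<N. K / k * ((k - 2) * k * K * 2 ^ j - (k - 2) * (2 * k) ^ j
      + (k\<^sup>2 + k - 2 - (k + 2) * (a * b)) * k ^ j + 2 * k * K * (a * b - k + 1)))"
    unfolding K_def using level_contribution_eq[OF _ assms(1)] \<open>k > 1\<close> by (intro sum.cong) auto
  also have "\<dots> = K / k * ((k - 2) * k * K * (\<Sum>j<N. 2 ^ j) - (k - 2) * (\<Sum>j<N. (2 * k) ^ j)
      + (k\<^sup>2 + k - 2 - (k + 2) * (a * b)) * (\<Sum>j<N. k ^ j) + N * (2 * k * K * (a * b - k + 1)))"
    by (simp only: sum_distrib_left[symmetric] sum.distrib sum_subtractf) (simp add: algebra_simps)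
  also have "(\<Sum>j<N. 2 ^ j) = T - 1"
    unfolding T_def by (subst geometric_sum) auto
  also have "(\<Sum>j<N. (2 * k) ^ j) = (T * K - 1) / (2 * k - 1)"
    unfolding T_def K_def using nz by (subst geometric_sum) (auto simp: power_mult_distrib)
  also have "(\<Sum>j<N. k ^ j) = (K - 1) / (k - 1)"
    unfolding K_def using nz by (subst geometric_sum) auto
  finally have sum: "?S = K / k * ((k - 2) * k * K * (T - 1) - (k - 2) * ((T * K - 1) / (2 * k - 1))
      + (k\<^sup>2 + k - 2 - (k + 2) * (a * b)) * ((K - 1) / (k - 1)) + N * (2 * k * K * (a * b - k + 1)))" .
  have "cycle_pairs k (Suc N) N a = (T - 1) * (K * (k * K - K)) + K\<^sup>2 * (a * b)"
    unfolding cycle_pairs_def K_def T_def power_Suc \<open>a + b = k\<close>[symmetric] by algebra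
  then show ?thesis by (simp add: edge_contribution_def Let_def \<open>a + b = k\<close> sum)
qed

definition edge_coeff :: "nat \<Rightarrow> real \<Rightarrow> real" where
  "edge_coeff n k =
      (k - 1) * (2 * k\<^sup>2 - 2 * k - 1) / (k ^ 3 * (2 * k - 1)) * 2 ^ n * k ^ (2 * n)
    - 2 * (k - 1) / k\<^sup>2 * n * k ^ (2 * n)
    + 2 * (k + 1) / k ^ 3 * k ^ (2 * n)
    - 2 * (k + 1) / (k * (2 * k - 1)) * k ^ n"

definition wiener_coeff :: "nat \<Rightarrow> real \<Rightarrow> real" where
  "wiener_coeff n k =
      2 / k\<^sup>2 * n * k ^ (2 * n)
    - (k\<^sup>2 + 2) / (k ^ 3 * (k - 1)) * k ^ (2 * n)
    + (k + 2) / (k\<^sup>2 * (k - 1)) * k ^ n"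

lemma edge_contribution_closed_form:
  fixes a b :: real
  assumes "a + b = k" "k > 1"
  shows "edge_contribution N a b = edge_coeff (Suc N) k + wiener_coeff (Suc N) k * (a * b)"
proof -
  define K :: real where "K = k ^ N"
  define T :: real where "T = 2 ^ N"
  have nz: "k \<noteq> 0" "k - 1 \<noteq> 0" "2 * k - 1 \<noteq> 0" using \<open>k > 1\<close> by auto
  have "k ^ (2 * Suc N) = (k * K)\<^sup>2" by (simp only: power_even_eq power_Suc K_def)
  then have powers: "k ^ (2 * Suc N) = k\<^sup>2 * K\<^sup>2" "k ^ Suc N = k * K" "2 ^ Suc N = 2 * T"
    by (simp_all add: power_mult_distrib K_def T_def)
  show ?thesis
    unfolding edge_contribution_geometric[OF assms] K_def[symmetric] T_def[symmetric]
      edge_coeff_def wiener_coeff_def powers of_nat_Suc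
    using nz by (simp add: divide_simps) algebra
qed

lemma (in tree_graph) wiener_schreier_eq:
  assumes "n \<ge> 1"
  defines "k \<equiv> real (card V)"
  shows "wiener (words V n) (schreier_rel V E n) =
    (k - 1) * edge_coeff n k + wiener_coeff n k * wiener V {(x, y). adj E x y}"
proof -
  obtain N where n: "n = Suc N" using \<open>n \<ge> 1\<close> by (cases n) auto
  have "edge_contribution N (side_card e True) (side_card e False) =
      edge_coeff n k + wiener_coeff n k * (real (side_card e True) * real (side_card e False))"
    if "e \<in> E" for e
  proof -
    have "card (ends e) \<le> card V" using finite_V ends_subset[OF that] by (rule card_mono)
    then have "k > 1" using edge_neq[OF that] by (simp add: k_def)
    then show ?thesis
      unfolding n using side_card_add[of e]
      by (intro edge_contribution_closed_form) (simp_all add: k_def flip: of_nat_add)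
  qed
  then have "wiener (words V n) (schreier_rel V E n) = (\<Sum>e\<in>E. edge_coeff n k
      + wiener_coeff n k * (real (side_card e True) * real (side_card e False)))"
    unfolding n wiener_schreier_sum_edges by (intro sum.cong refl) simp
  also have "\<dots> = real (card E) * edge_coeff n k + wiener_coeff n k * wiener V {(x, y). adj E x y}"
    by (simp add: sum.distrib wiener_tree sum_distrib_left)
  also have "real (card E) = k - 1" by (simp add: k_def flip: card_edges)
  finally show ?thesis .
qed

theorem theorem5p1:
  fixes V :: "'a set" and E :: "('a \<times> 'a) set" and n :: nat
  assumes "oriented_tree V E" and "n \<ge> 1"
  defines "k \<equiv> real (card V)"
  shows "wiener (words V n) (schreier_rel V E n) =
      (k - 1)^2 * (2 * k^2 - 2 * k - 1) / (k^3 * (2 * k - 1)) * 2^n * k^(2*n)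
    - 2 * (k - 1)^2 / k^2 * n * k^(2*n)
    + 2 * (k + 1) * (k - 1) / k^3 * k^(2*n)
    - 2 * (k + 1) * (k - 1) / (k * (2 * k - 1)) * k^n
    + (2 / k^2 * n * k^(2*n) - (k^2 + 2) / (k^3 * (k - 1)) * k^(2*n)
       + (k + 2) / (k^2 * (k - 1)) * k^n) * wiener V {(x, y). adj E x y}"
proof -
  interpret tree_graph V E using assms(1) by (rule tree_graph.intro)
  have "(k - 1) * edge_coeff n k =
      (k - 1)^2 * (2 * k^2 - 2 * k - 1) / (k^3 * (2 * k - 1)) * 2^n * k^(2*n)
    - 2 * (k - 1)^2 / k^2 * n * k^(2*n)
    + 2 * (k + 1) * (k - 1) / k^3 * k^(2*n)
    - 2 * (k + 1) * (k - 1) / (k * (2 * k - 1)) * k^n"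
    by (simp add: edge_coeff_def divide_inverse algebra_simps power2_eq_square)
  then show ?thesis
    using wiener_schreier_eq[OF \<open>n \<ge> 1\<close>] by (simp only: k_def wiener_coeff_def)
qed

end
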